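(* Let $K$ be a commutative ring and let $A\subseteq B$ be a left $(\varphi,\psi)$-bounded extension of $K$-algebras, where $\varphi:(\mathbb{N}^m,\preceq_1)\to(\mathbb{N}^n,\preceq)$ and $\psi:(\mathbb{N}^s,\preceq_2)\to(\mathbb{N}^n,\preceq)$ are morphisms of ordered monoids, $F=\{F_\alpha(A)\mid\alpha\in\mathbb{N}^m\}$ is the given $(\mathbb{N}^m,\preceq_1)$-filtration on $A$ and $x_1,\dots,x_s\in B$ are the given generators. For each $\alpha\in\mathbb{N}^n$ define the $K$-submodule of $B$ $$\mathfrak{F}_\alpha(B)=\sum_{\substack{(\alpha_1,\alpha_2)\in\mathbb{N}^m\times\mathbb{N}^s\\ \varphi(\alpha_1)+\psi(\alpha_2)\preceq\alpha}}F_{\alpha_1}(A)\,\mathbf{x}^{\alpha_2}.$$ Then $\mathfrak{F}=\{\mathfrak{F}_\alpha(B)\mid\alpha\in\mathbb{N}^n\}$ is an $(\mathbb{N}^n,\preceq)$-filtration on $B$.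
   Context: An admissible order on $\mathbb{N}^n$ is a total order $\preceq$ such that $\alpha\preceq\beta$ implies $\alpha+\gamma\preceq\beta+\gamma$, and $0\preceq\alpha$ for all $\alpha$. An $(\mathbb{N}^n,\preceq)$-filtration on a $K$-algebra $R$ is a family of $K$-submodules $\{F_\alpha(R)\mid\alpha\in\mathbb{N}^n\}$ with: $F_\alpha(R)\subseteq F_\beta(R)$ if $\alpha\preceq\beta$; $F_\gamma(R)F_\delta(R)\subseteq F_{\gamma+\delta}(R)$ for all $\gamma,\delta$; $\bigcup_\alpha F_\alpha(R)=R$; $1\in F_0(R)$. Bounded extensions. Let $\preceq_1,\preceq_2,\preceq$ be admissible orders on $\mathbb{N}^m,\mathbb{N}^s,\mathbb{N}^n$ and let $\varphi:\mathbb{N}^m\to\mathbb{N}^n$, $\psi:\mathbb{N}^s\to\mathbb{N}^n$ be morphisms of ordered monoids (order-preserving monoid homomorphisms). $\epsilon_1,\epsilon_2,\dots$ denote the canonical basis vectors. For $x_1,\dots,x_s\in B$ and $\gamma\in\mathbb{N}^s$ put $\mathbf{x}^\gamma=x_1^{\gamma_1}\cdots x_s^{\gamma_s}$. An extension of $K$-algebras $A\subseteq B$ is left $(\varphi,\psi)$-bounded if: (EA1) $A$ is endowed with an $(\mathbb{N}^m,\preceq_1)$-filtration $F=\{F_\alpha(A)\mid\alpha\in\mathbb{N}^m\}$; (EA2) $B$ is generated as a $K$-algebra by $A$ together with finitely many elements $x_1,\dots,x_s\in B$; (EA3) for each $i=1,\dots,s$ and $\alpha\in\mathbb{N}^m$,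 $x_iF_\alpha(A)\subseteq F_\alpha(A)x_i+\sum_{\varphi(\gamma_1)+\psi(\gamma_2)\prec\varphi(\alpha)+\psi(\epsilon_i)}F_{\gamma_1}(A)\mathbf{x}^{\gamma_2}$; (EA4) for all $1\leqslant i<j\leqslant s$ there is $q_{ji}\in F_0(A)$ with $x_jx_i-q_{ji}x_ix_j\in\sum_{\varphi(\gamma_1)+\psi(\gamma_2)\prec\psi(\epsilon_i+\epsilon_j)}F_{\gamma_1}(A)\mathbf{x}^{\gamma_2}$; the sums being over $(\gamma_1,\gamma_2)\in\mathbb{N}^m\times\mathbb{N}^s$. The case $m=0$ is allowed: $\mathbb{N}^0$ is trivial, the filtration on $A$ is trivial ($F_0(A)=A$) and $\varphi=0$. *)

theory Defs
  imports "HOL-Algebra.Module" "HOL-Algebra.Subrings" "HOL-Library.Function_Algebras"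
begin

section \<open>Admissible orders\<close>

text \<open>
  The monoid of n-tuples of natural numbers is represented by the functions supported on
  {..<n}, with the pointwise addition and zero of functions; n = 0 is allowed and gives
  the trivial monoid. Indices start at 0.
\<close>

definition Nvec :: "nat \<Rightarrow> (nat \<Rightarrow> nat) set" where
  "Nvec n = {\<alpha>. \<forall>i\<ge>n. \<alpha> i = 0}"

definition unit_vec :: "nat \<Rightarrow> nat \<Rightarrow> nat" where
  "unit_vec i = (\<lambda>j. if j = i then 1 else 0)"

text \<open>Orders are relations, as in \<^theory>\<open>HOL.Order_Relation\<close>; the strict part of r is r - Id.\<close>

locale admissible_order =
  fixes n :: nat and r :: "(nat \<Rightarrow> nat) rel"
  assumes linear: "linear_order_on (Nvec n) r"
    and add_mono: "\<And>\<alpha> \<beta> \<gamma>. \<lbrakk>(\<alpha>, \<beta>) \<in> r; \<gamma> \<in> Nvec n\<rbrakk> \<Longrightarrow> (\<alpha> + \<gamma>, \<beta> + \<gamma>) \<in> r"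
    and zero_least: "\<And>\<alpha>. \<alpha> \<in> Nvec n \<Longrightarrow> (0, \<alpha>) \<in> r"

text \<open>Only the values of the map on \<^term>\<open>Nvec m\<close> matter.\<close>

locale ordered_monoid_morphism =
  fixes m :: nat and r1 :: "(nat \<Rightarrow> nat) rel"
    and n :: nat and r :: "(nat \<Rightarrow> nat) rel"
    and h :: "(nat \<Rightarrow> nat) \<Rightarrow> (nat \<Rightarrow> nat)"
  assumes maps_to: "h \<in> Nvec m \<rightarrow> Nvec n"
    and map_zero: "h 0 = 0"
    and map_add: "\<And>\<alpha> \<beta>. \<lbrakk>\<alpha> \<in> Nvec m; \<beta> \<in> Nvec m\<rbrakk> \<Longrightarrow> h (\<alpha> + \<beta>) = h \<alpha> + h \<beta>"
    and map_mono: "\<And>\<alpha> \<beta>. (\<alpha>, \<beta>) \<in> r1 \<Longrightarrow> (h \<alpha>, h \<beta>) \<in> r"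

section \<open>Algebras and sums of submodules\<close>

text \<open>
  The library's \<^locale>\<open>algebra\<close> is commutative; here the algebra is an arbitrary associative
  unital ring on which the commutative ring K acts centrally.
\<close>

locale assoc_algebra = module K B + B?: ring B for K :: "('k, 'c) ring_scheme" (structure)
    and B :: "('k, 'b, 'd) module_scheme" (structure) +
  assumes smult_mult_left:
      "\<lbrakk>k \<in> carrier K; a \<in> carrier B; b \<in> carrier B\<rbrakk>
        \<Longrightarrow> (k \<odot>\<^bsub>B\<^esub> a) \<otimes>\<^bsub>B\<^esub> b = k \<odot>\<^bsub>B\<^esub> (a \<otimes>\<^bsub>B\<^esub> b)"
    and smult_mult_right:
      "\<lbrakk>k \<in> carrier K; a \<in> carrier B; b \<in> carrier B\<rbrakk>
        \<Longrightarrow> a \<otimes>\<^bsub>B\<^esub> (k \<odot>\<^bsub>B\<^esub> b) = k \<odot>\<^bsub>B\<^esub> (a \<otimes>\<^bsub>B\<^esub> b)"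

definition unital_subalgebra ::
  "'b set \<Rightarrow> ('k, 'c) ring_scheme \<Rightarrow> ('k, 'b, 'd) module_scheme \<Rightarrow> bool" where
  "unital_subalgebra A K B \<longleftrightarrow> subring A B \<and> submodule A K B"

definition generated_subalgebra ::
  "('k, 'c) ring_scheme \<Rightarrow> ('k, 'b, 'd) module_scheme \<Rightarrow> 'b set \<Rightarrow> 'b set" where
  "generated_subalgebra K B X = \<Inter> {S. unital_subalgebra S K B \<and> X \<subseteq> S}"

text \<open>The sum of a family of submodules, as the set of finite sums (zero if I is empty).\<close>

definition submodule_sum :: "('b, 'd) ring_scheme \<Rightarrow> 'i set \<Rightarrow> ('i \<Rightarrow> 'b set) \<Rightarrow> 'b set" where
  "submodule_sum B I S = {finsum B f J | f J. finite J \<and> J \<subseteq> I \<and> (\<forall>i\<in>J. f i \<in> S i)}"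

text \<open>The ordered monomial \<open>x 0 ^ \<gamma> 0 * \<dots> * x (s - 1) ^ \<gamma> (s - 1)\<close>.\<close>

definition monomial ::
  "('b, 'd) monoid_scheme \<Rightarrow> nat \<Rightarrow> (nat \<Rightarrow> 'b) \<Rightarrow> (nat \<Rightarrow> nat) \<Rightarrow> 'b" where
  "monomial B s x \<gamma> = foldr (\<otimes>\<^bsub>B\<^esub>) (map (\<lambda>i. x i [^]\<^bsub>B\<^esub> \<gamma> i) [0..<s]) \<one>\<^bsub>B\<^esub>"

section \<open>Filtrations\<close>

text \<open>
  \<open><#>\<close> is the set of products of single elements; as the right-hand side of \<open>mult_closed\<close> is a
  submodule, the inclusion is the same as for the submodule spanned by these products.
\<close>

locale filtered_algebra = assoc_algebra K R + admissible_order n r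
  for K :: "('k, 'c) ring_scheme" (structure)
    and R :: "('k, 'b, 'd) module_scheme" (structure) and n :: nat and r :: "(nat \<Rightarrow> nat) rel" +
  fixes F :: "(nat \<Rightarrow> nat) \<Rightarrow> 'b set"
  assumes submodule: "\<And>\<alpha>. \<alpha> \<in> Nvec n \<Longrightarrow> submodule (F \<alpha>) K R"
    and mono: "\<And>\<alpha> \<beta>. (\<alpha>, \<beta>) \<in> r \<Longrightarrow> F \<alpha> \<subseteq> F \<beta>"
    and mult_closed:
      "\<And>\<gamma> \<delta>. \<lbrakk>\<gamma> \<in> Nvec n; \<delta> \<in> Nvec n\<rbrakk> \<Longrightarrow> F \<gamma> <#>\<^bsub>R\<^esub> F \<delta> \<subseteq> F (\<gamma> + \<delta>)"
    and exhaustive: "(\<Union>\<alpha>\<in>Nvec n. F \<alpha>) = carrier R"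
    and one_mem: "\<one>\<^bsub>R\<^esub> \<in> F 0"

section \<open>Left bounded extensions\<close>

locale left_bounded_extension =
  assoc_algebra K B +
  Ord1: admissible_order m r1 + Ord2: admissible_order s r2 + Ord: admissible_order n r +
  Phi: ordered_monoid_morphism m r1 n r \<phi> + Psi: ordered_monoid_morphism s r2 n r \<psi>
  for K :: "('k, 'c) ring_scheme" (structure)
    and B :: "('k, 'b, 'd) module_scheme" (structure)
    and m :: nat and r1 :: "(nat \<Rightarrow> nat) rel"
    and s :: nat and r2 :: "(nat \<Rightarrow> nat) rel"
    and n :: nat and r :: "(nat \<Rightarrow> nat) rel"
    and \<phi> \<psi> :: "(nat \<Rightarrow> nat) \<Rightarrow> (nat \<Rightarrow> nat)" +
  fixes A :: "'b set" and F :: "(nat \<Rightarrow> nat) \<Rightarrow> 'b set" and x :: "nat \<Rightarrow> 'b"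
  assumes subalgebra_A: "unital_subalgebra A K B"
    and EA1: "filtered_algebra K (B\<lparr>carrier := A\<rparr>) m r1 F"
    and EA2_mem: "x \<in> {..<s} \<rightarrow> carrier B"
    and EA2: "generated_subalgebra K B (A \<union> x ` {..<s}) = carrier B"
    and EA3: "\<And>i \<alpha>. \<lbrakk>i < s; \<alpha> \<in> Nvec m\<rbrakk> \<Longrightarrow>
      x i <#\<^bsub>B\<^esub> F \<alpha> \<subseteq> (F \<alpha> #>\<^bsub>B\<^esub> x i) <+>\<^bsub>B\<^esub>
        submodule_sum B
          {(\<gamma>1, \<gamma>2) \<in> Nvec m \<times> Nvec s. (\<phi> \<gamma>1 + \<psi> \<gamma>2, \<phi> \<alpha> + \<psi> (unit_vec i)) \<in> r - Id}
          (\<lambda>(\<gamma>1, \<gamma>2). F \<gamma>1 #>\<^bsub>B\<^esub> monomial B s x \<gamma>2)"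
    and EA4: "\<And>i j. \<lbrakk>i < j; j < s\<rbrakk> \<Longrightarrow> \<exists>q \<in> F 0.
      (x j \<otimes>\<^bsub>B\<^esub> x i) \<ominus>\<^bsub>B\<^esub> (q \<otimes>\<^bsub>B\<^esub> x i \<otimes>\<^bsub>B\<^esub> x j) \<in>
        submodule_sum B
          {(\<gamma>1, \<gamma>2) \<in> Nvec m \<times> Nvec s. (\<phi> \<gamma>1 + \<psi> \<gamma>2, \<psi> (unit_vec i + unit_vec j)) \<in> r - Id}
          (\<lambda>(\<gamma>1, \<gamma>2). F \<gamma>1 #>\<^bsub>B\<^esub> monomial B s x \<gamma>2)"

end

theory Submission
  imports Defs
begin

text \<open>
  Write \<open>G \<theta>\<close> for the candidate filtration. The point is that left multiplication by \<open>x i\<close> maps \<open>G \<theta>\<close> into \<open>G (\<theta> + \<psi> (unit_vec i))\<close>; as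
  each \<open>F \<alpha>\<close> also multiplies \<open>G \<theta>\<close> into \<open>G (\<phi> \<alpha> + \<theta>)\<close>, closure under products and exhaustiveness
  follow. By Dickson's lemma an admissible order is well-founded, so one can argue by induction on
  the target degree \<open>\<tau>\<close>. The correction terms of EA3 and EA4 have strictly smaller degree and stay so
  after multiplication by further letters, because addition is cancellative; they are absorbed
  by the induction hypothesis. Letters may have degree zero, so the leading terms need not drop in
  degree when a letter is split off. They are controlled by an inner induction on the
  exponent, which straightens \<open>x i * x^\<beta>\<close> to \<open>c * x^(\<beta> + \<epsilon>\<^sub>i)\<close> with \<open>c \<in> F 0\<close> modulo strictly
  smaller degree.
\<close>

section \<open>Tuples of natural numbers\<close>

lemma zero_in_Nvec [simp]: "0 \<in> Nvec n"
  by (simp add: Nvec_def)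

lemma add_in_Nvec [simp]: "\<alpha> \<in> Nvec n \<Longrightarrow> \<beta> \<in> Nvec n \<Longrightarrow> \<alpha> + \<beta> \<in> Nvec n"
  by (simp add: Nvec_def)

lemma unit_vec_in_Nvec [simp]: "i < n \<Longrightarrow> unit_vec i \<in> Nvec n"
  by (simp add: Nvec_def unit_vec_def)

text \<open>Induction on the total degree, always splitting off the first nonzero coordinate
  \<open>j\<close>. The vanishing of \<open>\<beta>\<close> below \<open>j\<close> is what lets
  \<open>x j\<close> be put in front of the ordered monomial \<open>x^\<beta>\<close> without
  breaking the order of the letters.\<close>

lemma Nvec_induct [consumes 1, case_names zero add_unit]:
  assumes "\<beta> \<in> Nvec s" and "P 0"
    and step: "\<And>\<beta> j. \<lbrakk>\<beta> \<in> Nvec s; j < s; \<forall>k<j. \<beta> k = 0; P \<beta>\<rbrakk> \<Longrightarrow> P (\<beta> + unit_vec j)"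
  shows "P \<beta>"
  using assms(1)
proof (induction "\<Sum>k<s. \<beta> k" arbitrary: \<beta>)
  case 0
  then have "\<beta> = 0"
    by (auto simp: Nvec_def fun_eq_iff) (metis lessThan_iff linorder_not_le)
  with \<open>P 0\<close> show ?case by (simp only:)
next
  case (Suc N)
  define j where "j = (LEAST k. \<beta> k \<noteq> 0)"
  have "\<exists>k. \<beta> k \<noteq> 0" using Suc.hyps(2) by (metis sum.neutral nat.distinct(1))
  then have j: "\<beta> j \<noteq> 0" "\<forall>k<j. \<beta> k = 0"
    unfolding j_def by (auto intro: LeastI_ex dest: not_less_Least)
  then have js: "j < s" using Suc.prems by (metis (mono_tags, lifting) Nvec_def linorder_not_le mem_Collect_eq)
  \<comment> \<open>The truncated subtraction is exact, since coordinate \<open>j\<close> is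
    nonzero.\<close>
  define \<beta>' where "\<beta>' = \<beta>(j := \<beta> j - 1)"
  have eq: "\<beta> = \<beta>' + unit_vec j"
    using j(1) by (auto simp: \<beta>'_def unit_vec_def fun_eq_iff)
  have N': "\<beta>' \<in> Nvec s" using Suc.prems js by (auto simp: Nvec_def \<beta>'_def)
  have "(\<Sum>k<s. \<beta> k) = (\<Sum>k<s. \<beta>' k) + (\<Sum>k<s. unit_vec j k)"
    by (subst eq) (simp add: sum.distrib)
  also have "(\<Sum>k<s. unit_vec j k) = 1" using js by (simp add: unit_vec_def)
  finally have "N = (\<Sum>k<s. \<beta>' k)" using Suc.hyps(2) by simp
  from Suc.hyps(1)[OF this N'] have "P \<beta>'" .
  moreover have "\<forall>k<j. \<beta>' k = 0" using j(2) by (simp add: \<beta>'_def)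
  ultimately show ?case using step[OF N' js] eq by simp
qed

section \<open>Dickson's lemma for sequences of tuples\<close>

lemma nat_mono_subseq:
  fixes f :: "nat \<Rightarrow> nat"
  shows "\<exists>g :: nat \<Rightarrow> nat. strict_mono g \<and> mono (\<lambda>i. f (g i))"
proof -
  obtain g :: "nat \<Rightarrow> nat" where g: "strict_mono g" "monoseq (\<lambda>i. f (g i))"
    using seq_monosub[of f] by blast
  show ?thesis
  proof (cases "\<forall>i j. i \<le> j \<longrightarrow> f (g i) \<le> f (g j)")
    case True
    with g(1) show ?thesis by (auto simp: mono_def)
  next
    case False
    with g(2) have dec: "\<And>i j. i \<le> j \<Longrightarrow> f (g j) \<le> f (g i)"
      by (auto simp: monoseq_def)
    \<comment> \<open>A weakly decreasing sequence of naturals is constant from an index of its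
      minimum on, so the tail starting at \<open>N\<close> is also weakly increasing.\<close>
    define N where "N = (ARG_MIN (\<lambda>i. f (g i)) i. True)"
    have N: "f (g N) \<le> f (g i)" for i
      unfolding N_def by (rule arg_min_nat_le) simp
    have "strict_mono (\<lambda>i. g (i + N))"
      using g(1) by (simp add: strict_mono_def)
    moreover have "mono (\<lambda>i. f (g (i + N)))"
      using N dec by (intro monoI) (meson le_add2 order_trans)
    ultimately show ?thesis by blast
  qed
qed

text \<open>Coordinates are treated one after the other: passing to a further subsequence keeps the
  monotonicity already achieved.\<close>

lemma Dickson_subseq:
  fixes f :: "nat \<Rightarrow> nat \<Rightarrow> nat"
  shows "\<exists>g :: nat \<Rightarrow> nat. strict_mono g \<and> (\<forall>k<n. mono (\<lambda>i. f (g i) k))"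
proof (induction n)
  case 0
  show ?case by (intro exI[of _ id]) (simp add: strict_mono_def)
next
  case (Suc n)
  then obtain g :: "nat \<Rightarrow> nat" where g: "strict_mono g" "\<forall>k<n. mono (\<lambda>i. f (g i) k)" by blast
  obtain h :: "nat \<Rightarrow> nat" where h: "strict_mono h" "mono (\<lambda>i. f (g (h i)) n)"
    using nat_mono_subseq[of "\<lambda>i. f (g i) n"] by blast
  have "strict_mono (\<lambda>i. g (h i))" using g(1) h(1) by (simp add: strict_mono_def)
  moreover have "mono (\<lambda>i. f (g (h i)) k)" if "k < Suc n" for k
  proof (cases "k = n")
    case True
    with h(2) show ?thesis by simp
  next
    case False
    with that g(2) have "mono (\<lambda>i. f (g i) k)" by simp
    then show ?thesis using h(1) by (simp add: mono_def strict_mono_less_eq)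
  qed
  ultimately show ?case by blast
qed

section \<open>Admissible orders and their well-foundedness\<close>

context admissible_order
begin

lemma r_subset: "r \<subseteq> Nvec n \<times> Nvec n"
  using linear by (simp add: order_on_defs)

lemma r_memD: assumes "(\<alpha>, \<beta>) \<in> r" shows "\<alpha> \<in> Nvec n" "\<beta> \<in> Nvec n"
  using r_subset assms by auto

lemma r_refl: "\<alpha> \<in> Nvec n \<Longrightarrow> (\<alpha>, \<alpha>) \<in> r"
  using linear by (simp add: order_on_defs refl_on_def)

lemma r_trans: "(\<alpha>, \<beta>) \<in> r \<Longrightarrow> (\<beta>, \<gamma>) \<in> r \<Longrightarrow> (\<alpha>, \<gamma>) \<in> r"
  using linear by (auto simp: order_on_defs trans_def)

lemma r_antisym: "(\<alpha>, \<beta>) \<in> r \<Longrightarrow> (\<beta>, \<alpha>) \<in> r \<Longrightarrow> \<alpha> = \<beta>"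
  using linear by (auto simp: order_on_defs antisym_def)

lemma r_total: "\<alpha> \<in> Nvec n \<Longrightarrow> \<beta> \<in> Nvec n \<Longrightarrow> (\<alpha>, \<beta>) \<in> r \<or> (\<beta>, \<alpha>) \<in> r"
  using linear r_refl by (cases "\<alpha> = \<beta>") (auto simp: order_on_defs total_on_def)

lemma less_le_trans: "(\<alpha>, \<beta>) \<in> r - Id \<Longrightarrow> (\<beta>, \<gamma>) \<in> r \<Longrightarrow> (\<alpha>, \<gamma>) \<in> r - Id"
  using r_trans r_antisym by blast

lemma le_less_trans: "(\<alpha>, \<beta>) \<in> r \<Longrightarrow> (\<beta>, \<gamma>) \<in> r - Id \<Longrightarrow> (\<alpha>, \<gamma>) \<in> r - Id"
  using r_trans r_antisym by blast

lemma add_strict_mono: "(\<alpha>, \<beta>) \<in> r - Id \<Longrightarrow> \<gamma> \<in> Nvec n \<Longrightarrow> (\<alpha> + \<gamma>, \<beta> + \<gamma>) \<in> r - Id"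
  using add_mono by auto

lemma add_mono_left: "(\<alpha>, \<beta>) \<in> r \<Longrightarrow> \<gamma> \<in> Nvec n \<Longrightarrow> (\<gamma> + \<alpha>, \<gamma> + \<beta>) \<in> r"
  using add_mono by (simp add: add.commute)

lemma add_strict_mono_left: "(\<alpha>, \<beta>) \<in> r - Id \<Longrightarrow> \<gamma> \<in> Nvec n \<Longrightarrow> (\<gamma> + \<alpha>, \<gamma> + \<beta>) \<in> r - Id"
  using add_mono_left by auto

lemma le_add_right: "\<alpha> \<in> Nvec n \<Longrightarrow> \<gamma> \<in> Nvec n \<Longrightarrow> (\<alpha>, \<alpha> + \<gamma>) \<in> r"
  using add_mono_left[OF zero_least, of \<gamma> \<alpha>] by simp

lemma le_add_left: "\<alpha> \<in> Nvec n \<Longrightarrow> \<gamma> \<in> Nvec n \<Longrightarrow> (\<alpha>, \<gamma> + \<alpha>) \<in> r"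
  using le_add_right by (simp add: add.commute)

text \<open>By Dickson, an infinite descending chain has a later member that dominates an earlier
  one in every coordinate. The difference is a tuple, hence at least \<open>0\<close>, so the later
  member is not smaller.\<close>

lemma wf_strict: "wf (r - Id)"
  unfolding wf_iff_no_infinite_down_chain
proof
  assume "\<exists>f. \<forall>i. (f (Suc i), f i) \<in> r - Id"
  then obtain f where f: "\<And>i. (f (Suc i), f i) \<in> r - Id" by blast
  then have fN: "f i \<in> Nvec n" for i using r_memD by blast
  have desc: "(f j, f i) \<in> r - Id" if "i < j" for i j
    using that
  proof (induction j rule: less_Suc_induct)
    case (1 i) show ?case by (rule f)
  next
    case (2 i j k) then show ?case using less_le_trans by blast
  qed
  obtain g :: "nat \<Rightarrow> nat" where g: "strict_mono g" "\<forall>k<n. mono (\<lambda>i. f (g i) k)"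
    using Dickson_subseq by blast
  \<comment> \<open>Again an exact subtraction: the chosen subsequence is monotone in each
    coordinate below \<open>n\<close>, and both tuples vanish from \<open>n\<close> on.\<close>
  define \<gamma> where "\<gamma> = (\<lambda>k. f (g 1) k - f (g 0) k)"
  have "f (g 1) k = f (g 0) k + \<gamma> k" for k
    using g(2) fN by (cases "k < n") (auto simp: \<gamma>_def Nvec_def mono_def)
  then have "f (g 1) = f (g 0) + \<gamma>" by (simp add: fun_eq_iff)
  moreover have "\<gamma> \<in> Nvec n" using fN by (auto simp: \<gamma>_def Nvec_def)
  ultimately have "(f (g 0), f (g 1)) \<in> r" using le_add_right fN by simp
  moreover have "(f (g 1), f (g 0)) \<in> r - Id"
    using desc g(1) by (simp add: strict_mono_less)
  ultimately show False using r_antisym by blast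
qed

end

section \<open>Sums of submodules\<close>

context module
begin

lemma submodule_zero: "submodule H R M \<Longrightarrow> \<zero>\<^bsub>M\<^esub> \<in> H"
  using subgroup.one_closed[OF submodule.axioms(1)] by fastforce

lemma submodule_finsum:
  assumes H: "submodule H R M" and "finite J" and "\<And>j. j \<in> J \<Longrightarrow> f j \<in> H"
  shows "finsum M f J \<in> H"
  using assms(2,3)
proof (induction J)
  case empty
  then show ?case using submodule_zero[OF H] by simp
next
  case (insert j J)
  then have "f \<in> J \<rightarrow> carrier M" "f j \<in> carrier M"
    using submoduleE(1)[OF H] by auto
  with insert show ?case using submoduleE(5)[OF H] by simp
qed

lemma submodule_sum_least:
  assumes "submodule N R M" and "\<And>i. i \<in> I \<Longrightarrow> S i \<subseteq> N"
  shows "submodule_sum M I S \<subseteq> N"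
  using assms by (fastforce simp: submodule_sum_def intro!: submodule_finsum)

lemma submodule_sum_upper:
  assumes "i \<in> I" and "a \<in> S i" and "a \<in> carrier M"
  shows "a \<in> submodule_sum M I S"
proof -
  have "finsum M (\<lambda>_. a) {i} = a" using assms(3) by simp
  then show ?thesis unfolding submodule_sum_def using assms(1,2)
    by (auto intro!: exI[of _ "\<lambda>_. a"] exI[of _ "{i}"])
qed

text \<open>Together with \<open>submodule_sum_least\<close> and \<open>submodule_sum_upper\<close>
  this shows that the set of finite sums is the submodule generated by the summands.\<close>

lemma submodule_sum_submodule:
  assumes S: "\<And>i. i \<in> I \<Longrightarrow> submodule (S i) R M"
  shows "submodule (submodule_sum M I S) R M"
proof (rule submoduleI)
  have car: "f \<in> J \<rightarrow> carrier M" if "J \<subseteq> I" "\<forall>i\<in>J. f i \<in> S i" for f J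
    using that submoduleE(1)[OF S] by blast
  show "submodule_sum M I S \<subseteq> carrier M"
    by (rule submodule_sum_least[OF carrier_is_submodule]) (use submoduleE(1)[OF S] in blast)
  have smult: "k \<odot>\<^bsub>M\<^esub> a \<in> submodule_sum M I S"
    if k: "k \<in> carrier R" and a: "a \<in> submodule_sum M I S" for k a
  proof -
    from a obtain f J where J: "finite J" "J \<subseteq> I" "\<forall>i\<in>J. f i \<in> S i" "a = finsum M f J"
      by (auto simp: submodule_sum_def)
    then have "k \<odot>\<^bsub>M\<^esub> a = finsum M (\<lambda>i. k \<odot>\<^bsub>M\<^esub> f i) J"
      using finsum_smult_ldistr[OF J(1) k car] by simp
    moreover have "\<forall>i\<in>J. k \<odot>\<^bsub>M\<^esub> f i \<in> S i"
      using J submoduleE(4)[OF S] k by blast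
    ultimately show ?thesis using J(1,2) by (auto simp: submodule_sum_def)
  qed
  then show "\<And>k a. k \<in> carrier R \<Longrightarrow> a \<in> submodule_sum M I S
      \<Longrightarrow> k \<odot>\<^bsub>M\<^esub> a \<in> submodule_sum M I S" .
  show "\<zero>\<^bsub>M\<^esub> \<in> submodule_sum M I S"
    unfolding submodule_sum_def by (auto intro!: exI[of _ "{}"])
  fix a assume a: "a \<in> submodule_sum M I S"
  have "a \<in> carrier M"
    using a \<open>submodule_sum M I S \<subseteq> carrier M\<close> by blast
  \<comment> \<open>Negation is scalar multiplication by minus one, so it reduces to
    \<open>smult\<close>.\<close>
  then have "\<ominus>\<^bsub>M\<^esub> a = (\<ominus>\<^bsub>R\<^esub> \<one>\<^bsub>R\<^esub>) \<odot>\<^bsub>M\<^esub> a"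
    using smult_l_minus[of "\<one>\<^bsub>R\<^esub>" a] by simp
  then show "\<ominus>\<^bsub>M\<^esub> a \<in> submodule_sum M I S" using smult[OF _ a] by simp
next
  fix a b assume a: "a \<in> submodule_sum M I S" and b: "b \<in> submodule_sum M I S"
  from a obtain f J where f: "finite J" "J \<subseteq> I" "\<forall>i\<in>J. f i \<in> S i" "a = finsum M f J"
    by (auto simp: submodule_sum_def)
  from b obtain g L where g: "finite L" "L \<subseteq> I" "\<forall>i\<in>L. g i \<in> S i" "b = finsum M g L"
    by (auto simp: submodule_sum_def)
  \<comment> \<open>The two finite sums may have different supports. Extending both families by zero
    lets them be added termwise over \<open>J \<union> L\<close>.\<close>
  define f' where "f' i = (if i \<in> J then f i else \<zero>\<^bsub>M\<^esub>)" for i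
  define g' where "g' i = (if i \<in> L then g i else \<zero>\<^bsub>M\<^esub>)" for i
  have f'S: "\<forall>i\<in>I. f' i \<in> S i" and g'S: "\<forall>i\<in>I. g' i \<in> S i"
    using f g submodule_zero[OF S] by (auto simp: f'_def g'_def)
  have sub: "S i \<subseteq> carrier M" if "i \<in> I" for i using submoduleE(1)[OF S[OF that]] .
  have c: "f' \<in> J \<union> L \<rightarrow> carrier M" "g' \<in> J \<union> L \<rightarrow> carrier M"
    using f'S g'S sub f(2) g(2) by blast+
  have "a = finsum M f' (J \<union> L)"
    unfolding f(4)
  proof (rule add.finprod_mono_neutral_cong_left)
    show "finite (J \<union> L)" using f(1) g(1) by simp
  qed (use c f'_def in auto)
  moreover have "b = finsum M g' (J \<union> L)"
    unfolding g(4)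
  proof (rule add.finprod_mono_neutral_cong_left)
    show "finite (J \<union> L)" using f(1) g(1) by simp
  qed (use c g'_def in auto)
  ultimately have "a \<oplus>\<^bsub>M\<^esub> b = finsum M (\<lambda>i. f' i \<oplus>\<^bsub>M\<^esub> g' i) (J \<union> L)"
    using finsum_addf[OF c] by simp
  moreover have "\<forall>i\<in>J \<union> L. f' i \<oplus>\<^bsub>M\<^esub> g' i \<in> S i"
    using f'S g'S f(2) g(2) submoduleE(5)[OF S] by blast
  ultimately show "a \<oplus>\<^bsub>M\<^esub> b \<in> submodule_sum M I S"
    unfolding submodule_sum_def using f(1,2) g(1,2)
    by (auto intro!: exI[of _ "\<lambda>i. f' i \<oplus>\<^bsub>M\<^esub> g' i"] exI[of _ "J \<union> L"])
qed

end

section \<open>Submodules under one-sided multiplication\<close>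

context assoc_algebra
begin

text \<open>This allows an inclusion of the form \<open>c * S \<subseteq> N\<close> to be tested on
  generators of \<open>S\<close> only. Scalars can be moved past \<open>c\<close> because they act
  centrally.\<close>

lemma submodule_vimage_mult_left:
  assumes c: "c \<in> carrier B" and N: "submodule N K B"
  shows "submodule {z \<in> carrier B. c \<otimes>\<^bsub>B\<^esub> z \<in> N} K B"
  using assms submoduleE(3-5)[OF N] submodule_zero[OF N]
  by (intro submoduleI) (auto simp: B.r_distr B.r_minus smult_mult_right)

lemma submodule_vimage_mult_right:
  assumes c: "c \<in> carrier B" and N: "submodule N K B"
  shows "submodule {z \<in> carrier B. z \<otimes>\<^bsub>B\<^esub> c \<in> N} K B"
  using assms submoduleE(3-5)[OF N] submodule_zero[OF N]
  by (intro submoduleI) (auto simp: B.l_distr B.l_minus smult_mult_left)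

text \<open>Hence each \<open>F \<alpha> * x^\<beta>\<close>, as a set of single products, is
  already a legitimate summand of \<open>submodule_sum\<close>.\<close>

lemma submodule_r_coset:
  assumes c: "c \<in> carrier B" and N: "submodule N K B"
  shows "submodule (N #>\<^bsub>B\<^esub> c) K B"
proof (rule submoduleI)
  note E = submoduleE[OF N]
  have sub: "a \<in> carrier B" if "a \<in> N" for a using E(1) that by blast
  show "N #>\<^bsub>B\<^esub> c \<subseteq> carrier B" using c sub by (auto simp: r_coset_def)
  show "\<zero>\<^bsub>B\<^esub> \<in> N #>\<^bsub>B\<^esub> c"
    using c submodule_zero[OF N] by (auto simp: r_coset_def intro!: bexI[of _ "\<zero>\<^bsub>B\<^esub>"])
  show "\<ominus>\<^bsub>B\<^esub> a \<in> N #>\<^bsub>B\<^esub> c" if "a \<in> N #>\<^bsub>B\<^esub> c" for a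
    using that c sub E(3) by (auto simp: r_coset_def B.l_minus[symmetric])
  show "a \<oplus>\<^bsub>B\<^esub> b \<in> N #>\<^bsub>B\<^esub> c" if "a \<in> N #>\<^bsub>B\<^esub> c" "b \<in> N #>\<^bsub>B\<^esub> c" for a b
    using that c sub E(5) by (auto simp: r_coset_def B.l_distr[symmetric])
  show "k \<odot>\<^bsub>B\<^esub> a \<in> N #>\<^bsub>B\<^esub> c" if "k \<in> carrier K" "a \<in> N #>\<^bsub>B\<^esub> c" for k a
    using that c sub E(4) by (auto simp: r_coset_def smult_mult_left[symmetric])
qed

end

section \<open>Monomials\<close>

lemma (in monoid) foldr_mult_closed:
  "set ys \<subseteq> carrier G \<Longrightarrow> z \<in> carrier G \<Longrightarrow> foldr (\<otimes>) ys z \<in> carrier G"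
  by (induction ys) auto

lemma (in monoid) foldr_mult_one:
  "\<forall>y\<in>set ys. y = \<one> \<Longrightarrow> z \<in> carrier G \<Longrightarrow> foldr (\<otimes>) ys z = z"
  by (induction ys) auto

lemma (in monoid) monomial_closed:
  assumes "x \<in> {..<s} \<rightarrow> carrier G"
  shows "monomial G s x \<gamma> \<in> carrier G"
  unfolding monomial_def using assms by (intro foldr_mult_closed) auto

lemma (in monoid) monomial_zero: "monomial G s x 0 = \<one>"
  unfolding monomial_def by (rule foldr_mult_one) auto

text \<open>All factors before position \<open>i\<close> are powers with exponent zero, so
  \<open>x i\<close> can be absorbed into the first factor that matters. No commutation is
  involved.\<close>

lemma (in monoid) monomial_add_unit_vec:
  assumes x: "x \<in> {..<s} \<rightarrow> carrier G" and i: "i < s" and z: "\<forall>k<i. \<gamma> k = 0"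
  shows "monomial G s x (\<gamma> + unit_vec i) = x i \<otimes> monomial G s x \<gamma>"
proof -
  have split: "[0..<s] = [0..<i] @ i # [Suc i..<s]"
    using i by (metis le_add_diff_inverse less_imp_le_nat upt_add_eq_append upt_conv_Cons zero_le)
  define t where "t = foldr (\<otimes>) (map (\<lambda>k. x k [^] \<gamma> k) [Suc i..<s]) \<one>"
  have t: "t \<in> carrier G"
    unfolding t_def using x by (intro foldr_mult_closed) auto
  have xi: "x i \<in> carrier G" using x i by auto
  \<comment> \<open>The unit vector vanishes beyond \<open>i\<close>, so both monomials share the
    tail \<open>t\<close>.\<close>
  have tail: "map (\<lambda>k. x k [^] (\<gamma> + unit_vec i) k) [Suc i..<s] = map (\<lambda>k. x k [^] \<gamma> k) [Suc i..<s]"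
    by (auto simp: unit_vec_def)
  have "monomial G s x (\<gamma> + unit_vec i) = x i [^] Suc (\<gamma> i) \<otimes> t"
    unfolding monomial_def split map_append foldr_append list.map foldr.simps comp_def tail
      t_def[symmetric]
    by (subst foldr_mult_one) (use z xi t in \<open>auto simp: unit_vec_def\<close>)
  moreover have "monomial G s x \<gamma> = x i [^] \<gamma> i \<otimes> t"
    unfolding monomial_def split map_append foldr_append list.map foldr.simps comp_def
      t_def[symmetric]
    by (subst foldr_mult_one) (use z xi t in auto)
  ultimately show ?thesis
    using t nat_pow_Suc2[OF xi, of "\<gamma> i"] by (simp add: m_assoc[symmetric] xi del: nat_pow_Suc)
qed

section \<open>The filtration of a left bounded extension\<close>

context left_bounded_extension
begin

section \<open>The given filtration viewed inside \<open>B\<close>\<close>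

interpretation FA: filtered_algebra K "B\<lparr>carrier := A\<rparr>" m r1 F
  by (rule EA1)

lemma A_subset: "A \<subseteq> carrier B"
  using subalgebra_A submoduleE(1) by (simp add: unital_subalgebra_def)

lemma F_subset: "\<alpha> \<in> Nvec m \<Longrightarrow> F \<alpha> \<subseteq> carrier B"
  using FA.submoduleE(1)[OF FA.submodule] A_subset by fastforce

lemma F_carrier: "\<alpha> \<in> Nvec m \<Longrightarrow> a \<in> F \<alpha> \<Longrightarrow> a \<in> carrier B"
  using F_subset by blast

lemma F_submodule: assumes "\<alpha> \<in> Nvec m" shows "submodule (F \<alpha>) K B"
proof (rule submoduleI)
  note S = FA.submodule[OF assms]
  show "F \<alpha> \<subseteq> carrier B" by (rule F_subset[OF assms])
  show "\<zero>\<^bsub>B\<^esub> \<in> F \<alpha>" using FA.submodule_zero[OF S] by simp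
  show add: "a \<oplus>\<^bsub>B\<^esub> b \<in> F \<alpha>" if "a \<in> F \<alpha>" "b \<in> F \<alpha>" for a b
    using FA.submoduleE(5)[OF S that] by simp
  show smult: "k \<odot>\<^bsub>B\<^esub> a \<in> F \<alpha>" if "k \<in> carrier K" "a \<in> F \<alpha>" for k a
    using FA.submoduleE(4)[OF S that] by simp
  \<comment> \<open>The additive inverse depends on the carrier, unlike addition and scalar action,
    which \<open>A\<close> shares with \<open>B\<close>. It is therefore expressed by the scalar
    minus one.\<close>
  show "\<ominus>\<^bsub>B\<^esub> a \<in> F \<alpha>" if "a \<in> F \<alpha>" for a
    using smult[OF _ that, of "\<ominus> \<one>"] smult_l_minus[of \<one> a] F_carrier[OF assms that] by simp
qed

lemma F_mult:
  "\<alpha> \<in> Nvec m \<Longrightarrow> \<beta> \<in> Nvec m \<Longrightarrow> a \<in> F \<alpha> \<Longrightarrow> b \<in> F \<beta> \<Longrightarrow> a \<otimes>\<^bsub>B\<^esub> b \<in> F (\<alpha> + \<beta>)"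
  using FA.mult_closed[of \<alpha> \<beta>] by (auto simp: set_mult_def)

lemma F_one: "\<one>\<^bsub>B\<^esub> \<in> F 0"
  using FA.one_mem by simp

lemma F_exhaustive: "(\<Union>\<alpha>\<in>Nvec m. F \<alpha>) = A"
  using FA.exhaustive by simp

lemma x_closed [simp]: "i < s \<Longrightarrow> x i \<in> carrier B"
  using EA2_mem by auto

lemma \<phi>_Nvec [simp]: "\<alpha> \<in> Nvec m \<Longrightarrow> \<phi> \<alpha> \<in> Nvec n"
  using Phi.maps_to by auto

lemma \<psi>_Nvec [simp]: "\<beta> \<in> Nvec s \<Longrightarrow> \<psi> \<beta> \<in> Nvec n"
  using Psi.maps_to by auto

abbreviation mon :: "(nat \<Rightarrow> nat) \<Rightarrow> 'b" where
  "mon \<equiv> monomial B s x"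

lemma mon_closed [simp]: "mon \<gamma> \<in> carrier B"
  by (rule B.monomial_closed[OF EA2_mem])

section \<open>Spans of terms of prescribed degree\<close>

definition weighted_span :: "(nat \<Rightarrow> nat) set \<Rightarrow> 'b set" where
  "weighted_span D = submodule_sum B
     {(\<gamma>1, \<gamma>2) \<in> Nvec m \<times> Nvec s. \<phi> \<gamma>1 + \<psi> \<gamma>2 \<in> D} (\<lambda>(\<gamma>1, \<gamma>2). F \<gamma>1 #>\<^bsub>B\<^esub> mon \<gamma>2)"

abbreviation G :: "(nat \<Rightarrow> nat) \<Rightarrow> 'b set" where
  "G \<theta> \<equiv> weighted_span {w. (w, \<theta>) \<in> r}"

abbreviation L :: "(nat \<Rightarrow> nat) \<Rightarrow> 'b set" where
  "L \<theta> \<equiv> weighted_span {w. (w, \<theta>) \<in> r - Id}"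

lemma weighted_span_submodule: "submodule (weighted_span D) K B"
  unfolding weighted_span_def
  by (rule submodule_sum_submodule) (auto intro!: submodule_r_coset F_submodule)

lemmas span_add = submoduleE(5)[OF weighted_span_submodule]

lemma span_closed: "z \<in> weighted_span D \<Longrightarrow> z \<in> carrier B"
  using submoduleE(1)[OF weighted_span_submodule] by blast

lemma span_gen:
  assumes "\<alpha> \<in> Nvec m" "\<beta> \<in> Nvec s" "\<phi> \<alpha> + \<psi> \<beta> \<in> D" "a \<in> F \<alpha>"
  shows "a \<otimes>\<^bsub>B\<^esub> mon \<beta> \<in> weighted_span D"
  unfolding weighted_span_def
  by (rule submodule_sum_upper[where i = "(\<alpha>, \<beta>)"])
    (use assms F_carrier in \<open>auto simp: r_coset_def\<close>)

lemma mon_in_G: assumes "\<beta> \<in> Nvec s" shows "mon \<beta> \<in> G (\<psi> \<beta>)"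
  using span_gen[OF zero_in_Nvec assms _ F_one, of "{w. (w, \<psi> \<beta>) \<in> r}"] assms
  by (simp add: Phi.map_zero Ord.r_refl)

lemma span_least:
  assumes "submodule N K B"
    and "\<And>\<alpha> \<beta> a. \<lbrakk>\<alpha> \<in> Nvec m; \<beta> \<in> Nvec s; \<phi> \<alpha> + \<psi> \<beta> \<in> D; a \<in> F \<alpha>\<rbrakk> \<Longrightarrow> a \<otimes>\<^bsub>B\<^esub> mon \<beta> \<in> N"
  shows "weighted_span D \<subseteq> N"
  unfolding weighted_span_def
  by (rule submodule_sum_least[OF assms(1)]) (use assms(2) in \<open>auto simp: r_coset_def\<close>)

lemma span_mono: assumes "D \<subseteq> D'" shows "weighted_span D \<subseteq> weighted_span D'"
  by (rule span_least[OF weighted_span_submodule]) (use assms span_gen in blast)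

lemma G_mono: "(\<theta>, \<theta>') \<in> r \<Longrightarrow> G \<theta> \<subseteq> G \<theta>'"
  using Ord.r_trans by (intro span_mono) blast

lemma G_L_mono: "(\<theta>, \<theta>') \<in> r - Id \<Longrightarrow> G \<theta> \<subseteq> L \<theta>'"
  using Ord.le_less_trans by (intro span_mono) blast

lemma L_G: "L \<theta> \<subseteq> G \<theta>"
  by (intro span_mono) blast

lemma mult_left_span:
  assumes "z \<in> weighted_span D" "c \<in> carrier B" "submodule N K B"
    and "\<And>\<alpha> \<beta> a. \<lbrakk>\<alpha> \<in> Nvec m; \<beta> \<in> Nvec s; \<phi> \<alpha> + \<psi> \<beta> \<in> D; a \<in> F \<alpha>\<rbrakk>
      \<Longrightarrow> c \<otimes>\<^bsub>B\<^esub> (a \<otimes>\<^bsub>B\<^esub> mon \<beta>) \<in> N"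
  shows "c \<otimes>\<^bsub>B\<^esub> z \<in> N"
proof -
  have "weighted_span D \<subseteq> {z \<in> carrier B. c \<otimes>\<^bsub>B\<^esub> z \<in> N}"
    by (rule span_least[OF submodule_vimage_mult_left[OF assms(2,3)]])
      (use assms(4) F_carrier in auto)
  with assms(1) show ?thesis by blast
qed

lemma mult_right_span:
  assumes "z \<in> weighted_span D" "c \<in> carrier B" "submodule N K B"
    and "\<And>\<alpha> \<beta> a. \<lbrakk>\<alpha> \<in> Nvec m; \<beta> \<in> Nvec s; \<phi> \<alpha> + \<psi> \<beta> \<in> D; a \<in> F \<alpha>\<rbrakk>
      \<Longrightarrow> (a \<otimes>\<^bsub>B\<^esub> mon \<beta>) \<otimes>\<^bsub>B\<^esub> c \<in> N"
  shows "z \<otimes>\<^bsub>B\<^esub> c \<in> N"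
proof -
  have "weighted_span D \<subseteq> {z \<in> carrier B. z \<otimes>\<^bsub>B\<^esub> c \<in> N}"
    by (rule span_least[OF submodule_vimage_mult_right[OF assms(2,3)]])
      (use assms(4) F_carrier in auto)
  with assms(1) show ?thesis by blast
qed

text \<open>A coefficient multiplies from the left, where the coefficients already stand:
  \<open>a * (b * x^\<beta>) = (a * b) * x^\<beta>\<close>. Multiplicativity of \<open>F\<close> and
  additivity of \<open>\<phi>\<close> then give the shift of degree.\<close>

lemma F_mult_span:
  assumes \<alpha>: "\<alpha> \<in> Nvec m" and a: "a \<in> F \<alpha>" and z: "z \<in> weighted_span D"
    and D: "\<And>w. w \<in> D \<Longrightarrow> \<phi> \<alpha> + w \<in> D'"
  shows "a \<otimes>\<^bsub>B\<^esub> z \<in> weighted_span D'"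
proof (rule mult_left_span[OF z F_carrier[OF \<alpha> a] weighted_span_submodule])
  fix \<gamma> \<beta> b assume *: "\<gamma> \<in> Nvec m" "\<beta> \<in> Nvec s" "\<phi> \<gamma> + \<psi> \<beta> \<in> D" "b \<in> F \<gamma>"
  have "(a \<otimes>\<^bsub>B\<^esub> b) \<otimes>\<^bsub>B\<^esub> mon \<beta> \<in> weighted_span D'"
    using span_gen[of "\<alpha> + \<gamma>" \<beta> D' "a \<otimes>\<^bsub>B\<^esub> b"] * \<alpha> D[OF *(3)] F_mult[OF \<alpha> *(1) a *(4)]
    by (simp add: Phi.map_add add.assoc)
  then show "a \<otimes>\<^bsub>B\<^esub> (b \<otimes>\<^bsub>B\<^esub> mon \<beta>) \<in> weighted_span D'"
    using F_carrier[OF \<alpha> a] F_carrier[OF *(1,4)] by (simp add: B.m_assoc)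
qed

lemma F_mult_G:
  assumes "\<alpha> \<in> Nvec m" "a \<in> F \<alpha>" "z \<in> G \<theta>"
  shows "a \<otimes>\<^bsub>B\<^esub> z \<in> G (\<phi> \<alpha> + \<theta>)"
  by (rule F_mult_span[OF assms]) (use assms(1) Ord.add_mono_left in auto)

lemma F_mult_L:
  assumes "\<alpha> \<in> Nvec m" "a \<in> F \<alpha>" "z \<in> L \<theta>"
  shows "a \<otimes>\<^bsub>B\<^esub> z \<in> L (\<phi> \<alpha> + \<theta>)"
  by (rule F_mult_span[OF assms]) (use assms(1) Ord.add_strict_mono_left in auto)

section \<open>The relations EA3 and EA4 for single elements\<close>

lemma x_mult_F:
  assumes i: "i < s" and \<alpha>: "\<alpha> \<in> Nvec m" and a: "a \<in> F \<alpha>"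
  obtains a' l where "a' \<in> F \<alpha>" "l \<in> L (\<phi> \<alpha> + \<psi> (unit_vec i))"
    "x i \<otimes>\<^bsub>B\<^esub> a = (a' \<otimes>\<^bsub>B\<^esub> x i) \<oplus>\<^bsub>B\<^esub> l"
proof -
  have "x i \<otimes>\<^bsub>B\<^esub> a \<in> (F \<alpha> #>\<^bsub>B\<^esub> x i) <+>\<^bsub>B\<^esub> L (\<phi> \<alpha> + \<psi> (unit_vec i))"
    using EA3[OF i \<alpha>] a by (auto simp: l_coset_def weighted_span_def)
  then show ?thesis
    using that by (auto simp: set_add_def' r_coset_def)
qed

text \<open>EA4 with the roles of \<open>i\<close> and \<open>j\<close> exchanged and the difference
  resolved: an out-of-order pair \<open>x i * x j\<close> is rewritten in order, up to lower
  degree.\<close>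

lemma x_mult_x:
  assumes ji: "j < i" and i: "i < s"
  obtains q l where "q \<in> F 0" "l \<in> L (\<psi> (unit_vec j + unit_vec i))"
    "x i \<otimes>\<^bsub>B\<^esub> x j = (q \<otimes>\<^bsub>B\<^esub> x j \<otimes>\<^bsub>B\<^esub> x i) \<oplus>\<^bsub>B\<^esub> l"
proof -
  obtain q where q: "q \<in> F 0"
    and l: "(x i \<otimes>\<^bsub>B\<^esub> x j) \<ominus>\<^bsub>B\<^esub> (q \<otimes>\<^bsub>B\<^esub> x j \<otimes>\<^bsub>B\<^esub> x i) \<in> L (\<psi> (unit_vec j + unit_vec i))"
    using EA4[OF ji i] by (auto simp: weighted_span_def)
  define u v where "u = x i \<otimes>\<^bsub>B\<^esub> x j" and "v = q \<otimes>\<^bsub>B\<^esub> x j \<otimes>\<^bsub>B\<^esub> x i"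
  have "u \<in> carrier B" "v \<in> carrier B"
    using ji i F_carrier[OF zero_in_Nvec q] by (auto simp: u_def v_def)
  then have "u = v \<oplus>\<^bsub>B\<^esub> (u \<ominus>\<^bsub>B\<^esub> v)"
    by (simp add: a_minus_def M.a_lcomm M.r_neg)
  then show ?thesis using that[OF q l] by (simp add: u_def v_def)
qed

section \<open>Left multiplication by letters and monomials\<close>

text \<open>The letters of the monomial are applied one by one. Intermediate degrees lie below the
  final one, so the rule for letters is needed only on a downward closed set \<open>D\<close>.
  Inside the induction \<open>D\<close> consists of the degrees below \<open>\<tau>\<close>;
  afterwards it is \<open>UNIV\<close>.\<close>

lemma mon_mult_G_if:
  assumes x_mult: "\<And>i \<theta> z. \<lbrakk>i < s; \<theta> \<in> Nvec n; \<theta> + \<psi> (unit_vec i) \<in> D; z \<in> G \<theta>\<rbrakk>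
      \<Longrightarrow> x i \<otimes>\<^bsub>B\<^esub> z \<in> G (\<theta> + \<psi> (unit_vec i))"
    and down: "\<And>w w'. \<lbrakk>(w, w') \<in> r; w' \<in> D\<rbrakk> \<Longrightarrow> w \<in> D"
    and \<gamma>: "\<gamma> \<in> Nvec s" and \<theta>: "\<theta> \<in> Nvec n" and D: "\<psi> \<gamma> + \<theta> \<in> D" and z: "z \<in> G \<theta>"
  shows "mon \<gamma> \<otimes>\<^bsub>B\<^esub> z \<in> G (\<psi> \<gamma> + \<theta>)"
  using \<gamma> D
proof (induction \<gamma> rule: Nvec_induct)
  case zero
  have "mon 0 \<otimes>\<^bsub>B\<^esub> z \<in> G (\<psi> 0 + \<theta>)"
    using z span_closed[OF z] by (simp add: B.monomial_zero Psi.map_zero)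
  then show ?case .
next
  case (add_unit \<gamma> j)
  have eq: "\<psi> (\<gamma> + unit_vec j) + \<theta> = \<psi> \<gamma> + \<theta> + \<psi> (unit_vec j)"
    using add_unit.hyps by (simp add: Psi.map_add add_ac)
  have N: "\<psi> \<gamma> + \<theta> \<in> Nvec n" "\<psi> (unit_vec j) \<in> Nvec n" using add_unit.hyps \<theta> by simp_all
  have D: "\<psi> \<gamma> + \<theta> + \<psi> (unit_vec j) \<in> D"
    using add_unit.prems by (simp only: eq)
  have "mon \<gamma> \<otimes>\<^bsub>B\<^esub> z \<in> G (\<psi> \<gamma> + \<theta>)"
    by (rule add_unit.IH) (rule down[OF Ord.le_add_right[OF N] D])
  then have "x j \<otimes>\<^bsub>B\<^esub> (mon \<gamma> \<otimes>\<^bsub>B\<^esub> z) \<in> G (\<psi> (\<gamma> + unit_vec j) + \<theta>)"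
    unfolding eq by (rule x_mult[OF add_unit.hyps(2) N(1) D])
  then have "mon (\<gamma> + unit_vec j) \<otimes>\<^bsub>B\<^esub> z \<in> G (\<psi> (\<gamma> + unit_vec j) + \<theta>)"
    using add_unit.hyps span_closed[OF z]
    by (simp add: B.monomial_add_unit_vec[OF EA2_mem] B.m_assoc)
  then show ?case .
qed

lemma x_mult_G_step:
  assumes IH: "\<And>i \<theta> z. \<lbrakk>i < s; \<theta> \<in> Nvec n; (\<theta> + \<psi> (unit_vec i), \<tau>) \<in> r - Id; z \<in> G \<theta>\<rbrakk>
      \<Longrightarrow> x i \<otimes>\<^bsub>B\<^esub> z \<in> G (\<theta> + \<psi> (unit_vec i))"
    and i: "i < s" and \<theta>: "\<theta> \<in> Nvec n" and \<tau>: "\<tau> = \<theta> + \<psi> (unit_vec i)" and z: "z \<in> G \<theta>"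
  shows "x i \<otimes>\<^bsub>B\<^esub> z \<in> G \<tau>"
proof -
  have mon_G: "mon \<gamma> \<otimes>\<^bsub>B\<^esub> z \<in> G (\<psi> \<gamma> + \<theta>)"
    if "\<gamma> \<in> Nvec s" "\<theta> \<in> Nvec n" "(\<psi> \<gamma> + \<theta>, \<tau>) \<in> r - Id" "z \<in> G \<theta>" for \<gamma> \<theta> z
  proof (rule mon_mult_G_if[where D = "{w. (w, \<tau>) \<in> r - Id}", OF _ _ that(1,2) _ that(4)])
    show "w \<in> {w. (w, \<tau>) \<in> r - Id}" if "(w, w') \<in> r" "w' \<in> {w. (w, \<tau>) \<in> r - Id}" for w w'
      using Ord.le_less_trans[OF that(1)] that(2) by simp
  qed (use that(3) IH in auto)
  \<comment> \<open>Corrections arise to the left of a remaining monomial \<open>x^\<beta>\<close>.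
    On a generator \<open>b * x^\<gamma>2\<close> of \<open>L \<rho>\<close> the whole product has
    degree strictly below \<open>\<tau>\<close>, so \<open>mon_G\<close> applies to
    \<open>x^\<gamma>2 * x^\<beta>\<close>.\<close>
  have L_mon: "z \<otimes>\<^bsub>B\<^esub> mon \<beta> \<in> L (\<rho> + \<psi> \<beta>)"
    if \<rho>: "\<rho> \<in> Nvec n" and \<beta>: "\<beta> \<in> Nvec s" and le: "(\<rho> + \<psi> \<beta>, \<tau>) \<in> r" and z: "z \<in> L \<rho>"
    for \<rho> \<beta> z
  proof (rule mult_right_span[OF z mon_closed weighted_span_submodule])
    fix \<gamma>1 \<gamma>2 b
    assume *: "\<gamma>1 \<in> Nvec m" "\<gamma>2 \<in> Nvec s" "\<phi> \<gamma>1 + \<psi> \<gamma>2 \<in> {w. (w, \<rho>) \<in> r - Id}" "b \<in> F \<gamma>1"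
    have less: "(\<phi> \<gamma>1 + \<psi> \<gamma>2 + \<psi> \<beta>, \<rho> + \<psi> \<beta>) \<in> r - Id"
      using Ord.add_strict_mono[of "\<phi> \<gamma>1 + \<psi> \<gamma>2" \<rho> "\<psi> \<beta>"] *(3) \<beta> by simp
    then have "(\<phi> \<gamma>1 + (\<psi> \<gamma>2 + \<psi> \<beta>), \<tau>) \<in> r - Id"
      using Ord.less_le_trans[OF _ le] by (simp add: add.assoc)
    \<comment> \<open>Dropping the summand \<open>\<phi> \<gamma>1\<close> cannot raise the degree,
      because every tuple is at least \<open>0\<close>.\<close>
    then have "(\<psi> \<gamma>2 + \<psi> \<beta>, \<tau>) \<in> r - Id"
      by (rule Ord.le_less_trans[OF Ord.le_add_left, rotated -1]) (use *(1,2) \<beta> in simp_all)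
    then have "mon \<gamma>2 \<otimes>\<^bsub>B\<^esub> mon \<beta> \<in> G (\<psi> \<gamma>2 + \<psi> \<beta>)"
      by (rule mon_G[OF *(2) \<psi>_Nvec[OF \<beta>] _ mon_in_G[OF \<beta>]])
    then have "b \<otimes>\<^bsub>B\<^esub> (mon \<gamma>2 \<otimes>\<^bsub>B\<^esub> mon \<beta>) \<in> G (\<phi> \<gamma>1 + \<psi> \<gamma>2 + \<psi> \<beta>)"
      using F_mult_G[OF *(1,4)] by (simp add: add.assoc)
    then show "(b \<otimes>\<^bsub>B\<^esub> mon \<gamma>2) \<otimes>\<^bsub>B\<^esub> mon \<beta> \<in> L (\<rho> + \<psi> \<beta>)"
      using G_L_mono[OF less] F_carrier[OF *(1,4)] by (auto simp: B.m_assoc)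
  qed
  \<comment> \<open>Generators of \<open>L \<rho>\<close> have degree strictly below
    \<open>\<rho>\<close>, so multiplying them by \<open>x i\<close> lands strictly below
    \<open>\<tau>\<close> and \<open>IH\<close> applies, even if
    \<open>\<rho> + \<psi> (unit_vec i)\<close> equals \<open>\<tau>\<close>.\<close>
  have x_L: "x i \<otimes>\<^bsub>B\<^esub> z \<in> L (\<rho> + \<psi> (unit_vec i))"
    if i: "i < s" and \<rho>: "\<rho> \<in> Nvec n" and le: "(\<rho> + \<psi> (unit_vec i), \<tau>) \<in> r" and z: "z \<in> L \<rho>"
    for i \<rho> z
  proof (rule mult_left_span[OF z x_closed[OF i] weighted_span_submodule])
    fix \<gamma>1 \<gamma>2 b
    assume *: "\<gamma>1 \<in> Nvec m" "\<gamma>2 \<in> Nvec s" "\<phi> \<gamma>1 + \<psi> \<gamma>2 \<in> {w. (w, \<rho>) \<in> r - Id}" "b \<in> F \<gamma>1"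
    have N: "\<phi> \<gamma>1 + \<psi> \<gamma>2 \<in> Nvec n" using * by simp
    have less: "(\<phi> \<gamma>1 + \<psi> \<gamma>2 + \<psi> (unit_vec i), \<rho> + \<psi> (unit_vec i)) \<in> r - Id"
      using Ord.add_strict_mono[of "\<phi> \<gamma>1 + \<psi> \<gamma>2" \<rho> "\<psi> (unit_vec i)"] *(3) i by simp
    have "b \<otimes>\<^bsub>B\<^esub> mon \<gamma>2 \<in> G (\<phi> \<gamma>1 + \<psi> \<gamma>2)"
      by (rule span_gen) (use * N Ord.r_refl in auto)
    then show "x i \<otimes>\<^bsub>B\<^esub> (b \<otimes>\<^bsub>B\<^esub> mon \<gamma>2) \<in> L (\<rho> + \<psi> (unit_vec i))"
      using IH[OF i N Ord.less_le_trans[OF less le]] G_L_mono[OF less] by blast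
  qed
  \<comment> \<open>EA3 moves the letter past the coefficient. The new coefficient stays in
    \<open>F \<alpha>\<close>, and the correction, multiplied by \<open>x^\<beta>\<close>, stays
    lower by \<open>L_mon\<close>.\<close>
  have x_F_mon: "\<exists>a'\<in>F \<alpha>. \<exists>l\<in>L (\<phi> \<alpha> + \<psi> (unit_vec i) + \<psi> \<beta>).
      x i \<otimes>\<^bsub>B\<^esub> (a \<otimes>\<^bsub>B\<^esub> mon \<beta>) = a' \<otimes>\<^bsub>B\<^esub> (x i \<otimes>\<^bsub>B\<^esub> mon \<beta>) \<oplus>\<^bsub>B\<^esub> l"
    if i: "i < s" and \<alpha>: "\<alpha> \<in> Nvec m" and \<beta>: "\<beta> \<in> Nvec s" and a: "a \<in> F \<alpha>"
      and le: "(\<phi> \<alpha> + \<psi> (unit_vec i) + \<psi> \<beta>, \<tau>) \<in> r" for i \<alpha> \<beta> a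
  proof -
    obtain a' l where a': "a' \<in> F \<alpha>" and l: "l \<in> L (\<phi> \<alpha> + \<psi> (unit_vec i))"
      and eq: "x i \<otimes>\<^bsub>B\<^esub> a = (a' \<otimes>\<^bsub>B\<^esub> x i) \<oplus>\<^bsub>B\<^esub> l"
      by (rule x_mult_F[OF i \<alpha> a])
    note c = x_closed[OF i] F_carrier[OF \<alpha> a] F_carrier[OF \<alpha> a'] span_closed[OF l] mon_closed[of \<beta>]
    have "x i \<otimes>\<^bsub>B\<^esub> (a \<otimes>\<^bsub>B\<^esub> mon \<beta>) = ((a' \<otimes>\<^bsub>B\<^esub> x i) \<oplus>\<^bsub>B\<^esub> l) \<otimes>\<^bsub>B\<^esub> mon \<beta>"
      using c by (simp add: B.m_assoc[symmetric] eq)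
    also have "\<dots> = a' \<otimes>\<^bsub>B\<^esub> (x i \<otimes>\<^bsub>B\<^esub> mon \<beta>) \<oplus>\<^bsub>B\<^esub> l \<otimes>\<^bsub>B\<^esub> mon \<beta>"
      using c by (simp add: B.l_distr B.m_assoc)
    finally show ?thesis
      using a' L_mon[OF _ \<beta> le l] i \<alpha> by auto
  qed
  \<comment> \<open>The straightening, by the inner induction on the exponent. The coefficient
    \<open>c\<close> lies in \<open>F 0\<close> and adds no degree, since
    \<open>\<phi> 0 = 0\<close>.\<close>
  have x_mon: "\<exists>c\<in>F 0. \<exists>l\<in>L (\<psi> \<beta> + \<psi> (unit_vec i)).
      x i \<otimes>\<^bsub>B\<^esub> mon \<beta> = c \<otimes>\<^bsub>B\<^esub> mon (\<beta> + unit_vec i) \<oplus>\<^bsub>B\<^esub> l"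
    if "\<beta> \<in> Nvec s" "i < s" "(\<psi> \<beta> + \<psi> (unit_vec i), \<tau>) \<in> r" for \<beta> i
  proof -
    \<comment> \<open>If no letter before \<open>x i\<close> occurs, the product is already ordered:
      take \<open>c\<close> to be one and the correction to be zero.\<close>
    have ordered: "\<exists>c\<in>F 0. \<exists>l\<in>L (\<psi> \<beta> + \<psi> (unit_vec i)).
        x i \<otimes>\<^bsub>B\<^esub> mon \<beta> = c \<otimes>\<^bsub>B\<^esub> mon (\<beta> + unit_vec i) \<oplus>\<^bsub>B\<^esub> l"
      if "\<forall>k<i. \<beta> k = 0" "i < s" for \<beta> i
      using that F_one submodule_zero[OF weighted_span_submodule]
      by (intro bexI[of _ "\<one>\<^bsub>B\<^esub>"] bexI[of _ "\<zero>\<^bsub>B\<^esub>"])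
        (auto simp: B.monomial_add_unit_vec[OF EA2_mem])
    show ?thesis
      using that
    proof (induction \<beta> arbitrary: i rule: Nvec_induct)
      case zero
      show ?case by (rule ordered) (use zero in auto)
    next
      case (add_unit \<beta> j)
      show ?case
      proof (cases "i \<le> j")
        case True
        show ?thesis
          by (rule ordered) (use True add_unit.hyps add_unit.prems in \<open>auto simp: unit_vec_def\<close>)
      next
        case False
        then have ji: "j < i" by simp
        have i: "i < s" and j: "j < s" by (fact add_unit.prems(1) add_unit.hyps(2))+
        have \<beta>: "\<beta> \<in> Nvec s" by (fact add_unit.hyps(1))
        \<comment> \<open>\<open>T\<close> is the common degree of all leading terms below. Its
          third form, with \<open>\<phi> 0\<close>, matches \<open>x_F_mon\<close> for a coefficient
          in \<open>F 0\<close>.\<close>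
        define T where "T = \<psi> \<beta> + \<psi> (unit_vec i) + \<psi> (unit_vec j)"
        have T: "\<psi> (\<beta> + unit_vec j) + \<psi> (unit_vec i) = T"
          "\<psi> (unit_vec j + unit_vec i) + \<psi> \<beta> = T"
          "\<phi> 0 + \<psi> (unit_vec j) + \<psi> (\<beta> + unit_vec i) = T"
          using i j \<beta> by (simp_all add: T_def Psi.map_add Phi.map_zero add_ac)
        have "(\<psi> (\<beta> + unit_vec j) + \<psi> (unit_vec i), \<tau>) \<in> r" by (fact add_unit.prems(2))
        then have T\<tau>: "(T, \<tau>) \<in> r" by (simp only: T)
        have "(\<psi> \<beta> + \<psi> (unit_vec i), T) \<in> r"
          unfolding T_def using i j \<beta> by (intro Ord.le_add_right) auto
        \<comment> \<open>After EA4 has swapped \<open>x i\<close> and \<open>x j\<close>, the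
          letter \<open>x i\<close> meets the shorter monomial \<open>x^\<beta>\<close>. Leaving out
          \<open>x j\<close> cannot raise the degree, so the bound by \<open>\<tau>\<close>
          persists.\<close>
        from add_unit.IH[OF i Ord.r_trans[OF this T\<tau>]]
        obtain c l2 where c: "c \<in> F 0" and l2: "l2 \<in> L (\<psi> \<beta> + \<psi> (unit_vec i))"
          and eq2: "x i \<otimes>\<^bsub>B\<^esub> mon \<beta> = c \<otimes>\<^bsub>B\<^esub> mon (\<beta> + unit_vec i) \<oplus>\<^bsub>B\<^esub> l2"
          by blast
        obtain q l1 where q: "q \<in> F 0" and l1: "l1 \<in> L (\<psi> (unit_vec j + unit_vec i))"
          and eq1: "x i \<otimes>\<^bsub>B\<^esub> x j = (q \<otimes>\<^bsub>B\<^esub> x j \<otimes>\<^bsub>B\<^esub> x i) \<oplus>\<^bsub>B\<^esub> l1"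
          by (rule x_mult_x[OF ji i])
        have \<beta>i: "\<beta> + unit_vec i \<in> Nvec s" using \<beta> i by simp
        \<comment> \<open>The coefficient \<open>c\<close> produced by the inner induction now
          stands to the right of \<open>x j\<close>; EA3 carries \<open>x j\<close> across
          it.\<close>
        obtain c' l3 where c': "c' \<in> F 0" and l3: "l3 \<in> L T"
          and eq3: "x j \<otimes>\<^bsub>B\<^esub> (c \<otimes>\<^bsub>B\<^esub> mon (\<beta> + unit_vec i))
            = c' \<otimes>\<^bsub>B\<^esub> (x j \<otimes>\<^bsub>B\<^esub> mon (\<beta> + unit_vec i)) \<oplus>\<^bsub>B\<^esub> l3"
          using x_F_mon[OF j zero_in_Nvec \<beta>i c] T\<tau> unfolding T by blast
        have l4: "x j \<otimes>\<^bsub>B\<^esub> l2 \<in> L T"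
          unfolding T_def by (rule x_L[OF j _ _ l2]) (use i j \<beta> T\<tau> in \<open>simp_all add: T_def\<close>)
        have l5: "l1 \<otimes>\<^bsub>B\<^esub> mon \<beta> \<in> L T"
          using L_mon[OF _ \<beta> _ l1] T\<tau> i j unfolding T by simp
        have q_L: "q \<otimes>\<^bsub>B\<^esub> l \<in> L T" if "l \<in> L T" for l
          using F_mult_L[OF zero_in_Nvec q that] by (simp add: Phi.map_zero)
        note F0 = F_carrier[OF zero_in_Nvec]
        note car = x_closed[OF i] x_closed[OF j] mon_closed F0[OF c] F0[OF q] F0[OF c']
          span_closed[OF l1] span_closed[OF l2] span_closed[OF l3]
        \<comment> \<open>Here \<open>\<beta> + unit_vec i\<close> still vanishes below
          \<open>j\<close>, because \<open>j < i\<close>; so \<open>x j\<close> can be put in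
          front.\<close>
        have mon_j: "x j \<otimes>\<^bsub>B\<^esub> mon (\<beta> + unit_vec i) = mon (\<beta> + unit_vec j + unit_vec i)"
          using B.monomial_add_unit_vec[OF EA2_mem j, of "\<beta> + unit_vec i"] add_unit.hyps(3) ji
          by (simp add: unit_vec_def add_ac)
        have "x i \<otimes>\<^bsub>B\<^esub> mon (\<beta> + unit_vec j) = (x i \<otimes>\<^bsub>B\<^esub> x j) \<otimes>\<^bsub>B\<^esub> mon \<beta>"
          using B.monomial_add_unit_vec[OF EA2_mem j add_unit.hyps(3)] car by (simp add: B.m_assoc)
        also have "\<dots> = q \<otimes>\<^bsub>B\<^esub> (x j \<otimes>\<^bsub>B\<^esub> (x i \<otimes>\<^bsub>B\<^esub> mon \<beta>)) \<oplus>\<^bsub>B\<^esub> l1 \<otimes>\<^bsub>B\<^esub> mon \<beta>"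
          unfolding eq1 using car by (simp add: B.m_assoc B.l_distr)
        also have "\<dots> = q \<otimes>\<^bsub>B\<^esub> ((c' \<otimes>\<^bsub>B\<^esub> mon (\<beta> + unit_vec j + unit_vec i) \<oplus>\<^bsub>B\<^esub> l3)
            \<oplus>\<^bsub>B\<^esub> x j \<otimes>\<^bsub>B\<^esub> l2) \<oplus>\<^bsub>B\<^esub> l1 \<otimes>\<^bsub>B\<^esub> mon \<beta>"
          unfolding eq2 mon_j[symmetric] eq3[symmetric] using car by (simp add: B.r_distr)
        also have "\<dots> = (q \<otimes>\<^bsub>B\<^esub> c') \<otimes>\<^bsub>B\<^esub> mon (\<beta> + unit_vec j + unit_vec i)
            \<oplus>\<^bsub>B\<^esub> (q \<otimes>\<^bsub>B\<^esub> l3 \<oplus>\<^bsub>B\<^esub> q \<otimes>\<^bsub>B\<^esub> (x j \<otimes>\<^bsub>B\<^esub> l2) \<oplus>\<^bsub>B\<^esub> l1 \<otimes>\<^bsub>B\<^esub> mon \<beta>)"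
          using car by (simp add: B.r_distr B.m_assoc M.a_assoc)
        finally have "x i \<otimes>\<^bsub>B\<^esub> mon (\<beta> + unit_vec j)
          = (q \<otimes>\<^bsub>B\<^esub> c') \<otimes>\<^bsub>B\<^esub> mon (\<beta> + unit_vec j + unit_vec i)
            \<oplus>\<^bsub>B\<^esub> (q \<otimes>\<^bsub>B\<^esub> l3 \<oplus>\<^bsub>B\<^esub> q \<otimes>\<^bsub>B\<^esub> (x j \<otimes>\<^bsub>B\<^esub> l2) \<oplus>\<^bsub>B\<^esub> l1 \<otimes>\<^bsub>B\<^esub> mon \<beta>)" .
        moreover have "q \<otimes>\<^bsub>B\<^esub> c' \<in> F 0"
          using F_mult[OF zero_in_Nvec zero_in_Nvec q c'] by simp
        moreover have "q \<otimes>\<^bsub>B\<^esub> l3 \<oplus>\<^bsub>B\<^esub> q \<otimes>\<^bsub>B\<^esub> (x j \<otimes>\<^bsub>B\<^esub> l2) \<oplus>\<^bsub>B\<^esub> l1 \<otimes>\<^bsub>B\<^esub> mon \<beta> \<in> L T"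
          by (intro span_add q_L l3 l4 l5)
        ultimately have "\<exists>c\<in>F 0. \<exists>l\<in>L (\<psi> (\<beta> + unit_vec j) + \<psi> (unit_vec i)).
            x i \<otimes>\<^bsub>B\<^esub> mon (\<beta> + unit_vec j) = c \<otimes>\<^bsub>B\<^esub> mon (\<beta> + unit_vec j + unit_vec i) \<oplus>\<^bsub>B\<^esub> l"
          unfolding T by blast
        then show ?thesis .
      qed
    qed
  qed
  \<comment> \<open>On a generator \<open>a * x^\<beta>\<close> of \<open>G \<theta>\<close>, first
    \<open>x i\<close> is moved past \<open>a\<close>, then \<open>x i * x^\<beta>\<close> is
    straightened. Only the bound by \<open>\<tau>\<close> is needed now, so the corrections are
    weakened from \<open>L\<close> to \<open>G\<close>.\<close>
  show ?thesis
  proof (rule mult_left_span[OF z x_closed[OF i] weighted_span_submodule])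
    fix \<alpha> \<beta> a
    assume *: "\<alpha> \<in> Nvec m" "\<beta> \<in> Nvec s" "\<phi> \<alpha> + \<psi> \<beta> \<in> {w. (w, \<theta>) \<in> r}" "a \<in> F \<alpha>"
    have "(\<phi> \<alpha> + \<psi> \<beta> + \<psi> (unit_vec i), \<tau>) \<in> r"
      unfolding \<tau> using *(3) i Ord.add_mono by simp
    then have le: "(\<phi> \<alpha> + \<psi> (unit_vec i) + \<psi> \<beta>, \<tau>) \<in> r"
      "(\<phi> \<alpha> + (\<psi> \<beta> + \<psi> (unit_vec i)), \<tau>) \<in> r"
      by (simp_all add: add_ac)
    have N: "\<psi> \<beta> + \<psi> (unit_vec i) \<in> Nvec n" using * i by simp
    \<comment> \<open>As before, omitting \<open>\<phi> \<alpha>\<close> can only lower the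
      degree.\<close>
    have le': "(\<psi> \<beta> + \<psi> (unit_vec i), \<tau>) \<in> r"
      by (rule Ord.r_trans[OF Ord.le_add_left[OF N] le(2)]) (use * in simp)
    obtain a' l where a': "a' \<in> F \<alpha>" and l: "l \<in> L (\<phi> \<alpha> + \<psi> (unit_vec i) + \<psi> \<beta>)"
      and eq: "x i \<otimes>\<^bsub>B\<^esub> (a \<otimes>\<^bsub>B\<^esub> mon \<beta>) = a' \<otimes>\<^bsub>B\<^esub> (x i \<otimes>\<^bsub>B\<^esub> mon \<beta>) \<oplus>\<^bsub>B\<^esub> l"
      using x_F_mon[OF i *(1,2,4) le(1)] by blast
    obtain c l' where c: "c \<in> F 0" and l': "l' \<in> L (\<psi> \<beta> + \<psi> (unit_vec i))"
      and eq': "x i \<otimes>\<^bsub>B\<^esub> mon \<beta> = c \<otimes>\<^bsub>B\<^esub> mon (\<beta> + unit_vec i) \<oplus>\<^bsub>B\<^esub> l'"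
      using x_mon[OF *(2) i le'] by blast
    have "c \<otimes>\<^bsub>B\<^esub> mon (\<beta> + unit_vec i) \<in> G (\<psi> \<beta> + \<psi> (unit_vec i))"
      using F_mult_G[OF zero_in_Nvec c mon_in_G[of "\<beta> + unit_vec i"]] *(2) i
      by (simp add: Phi.map_zero Psi.map_add)
    then have "x i \<otimes>\<^bsub>B\<^esub> mon \<beta> \<in> G (\<psi> \<beta> + \<psi> (unit_vec i))"
      unfolding eq' using l' L_G by (intro span_add) auto
    from F_mult_G[OF *(1) a' this]
    have "a' \<otimes>\<^bsub>B\<^esub> (x i \<otimes>\<^bsub>B\<^esub> mon \<beta>) \<in> G \<tau>" using G_mono[OF le(2)] by blast
    moreover have "l \<in> G \<tau>" using l L_G G_mono[OF le(1)] by blast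
    ultimately show "x i \<otimes>\<^bsub>B\<^esub> (a \<otimes>\<^bsub>B\<^esub> mon \<beta>) \<in> G \<tau>"
      unfolding eq by (rule span_add)
  qed
qed

text \<open>Well-founded induction on the target degree, with letter, source degree and element all
  free: the corrections involve other letters and other source degrees.\<close>

lemma x_mult_G:
  assumes "i < s" "\<theta> \<in> Nvec n" "z \<in> G \<theta>"
  shows "x i \<otimes>\<^bsub>B\<^esub> z \<in> G (\<theta> + \<psi> (unit_vec i))"
  using assms
proof (induction "\<theta> + \<psi> (unit_vec i)" arbitrary: i \<theta> z rule: wf_induct_rule[OF Ord.wf_strict])
  case less: 1
  show ?case
    by (rule x_mult_G_step[OF _ less.prems(1,2) refl less.prems(3)]) (rule less.hyps)
qed

lemma mon_mult_G:
  assumes "\<gamma> \<in> Nvec s" "\<theta> \<in> Nvec n" "z \<in> G \<theta>"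
  shows "mon \<gamma> \<otimes>\<^bsub>B\<^esub> z \<in> G (\<psi> \<gamma> + \<theta>)"
  by (rule mon_mult_G_if[where D = UNIV, OF _ _ assms(1,2) _ assms(3)]) (simp_all add: x_mult_G)

section \<open>Products and exhaustiveness\<close>

text \<open>On generators, \<open>(a * x^\<beta>) * z = a * (x^\<beta> * z)\<close>: the monomial
  acts first by \<open>mon_mult_G\<close>, then the coefficient by \<open>F_mult_G\<close>.\<close>

lemma G_mult_G:
  assumes "\<theta> \<in> Nvec n" "\<eta> \<in> Nvec n" "y \<in> G \<theta>" "z \<in> G \<eta>"
  shows "y \<otimes>\<^bsub>B\<^esub> z \<in> G (\<theta> + \<eta>)"
proof (rule mult_right_span[OF assms(3) span_closed[OF assms(4)] weighted_span_submodule])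
  fix \<alpha> \<beta> a
  assume *: "\<alpha> \<in> Nvec m" "\<beta> \<in> Nvec s" "\<phi> \<alpha> + \<psi> \<beta> \<in> {w. (w, \<theta>) \<in> r}" "a \<in> F \<alpha>"
  have "a \<otimes>\<^bsub>B\<^esub> (mon \<beta> \<otimes>\<^bsub>B\<^esub> z) \<in> G (\<phi> \<alpha> + (\<psi> \<beta> + \<eta>))"
    by (rule F_mult_G[OF *(1,4) mon_mult_G[OF *(2) assms(2,4)]])
  moreover have "(\<phi> \<alpha> + (\<psi> \<beta> + \<eta>), \<theta> + \<eta>) \<in> r"
    using Ord.add_mono[of "\<phi> \<alpha> + \<psi> \<beta>" \<theta> \<eta>] *(3) assms(2) by (simp add: add.assoc)
  ultimately show "(a \<otimes>\<^bsub>B\<^esub> mon \<beta>) \<otimes>\<^bsub>B\<^esub> z \<in> G (\<theta> + \<eta>)"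
    using G_mono F_carrier[OF *(1,4)] span_closed[OF assms(4)] by (auto simp: B.m_assoc)
qed

lemma one_in_G: "\<one>\<^bsub>B\<^esub> \<in> G 0"
  using mon_in_G[OF zero_in_Nvec] by (simp add: B.monomial_zero Psi.map_zero)

text \<open>Totality of the order makes the family a chain; this is what closes its union under
  addition.\<close>

lemma G_common:
  assumes "\<theta> \<in> Nvec n" "\<eta> \<in> Nvec n" "y \<in> G \<theta>" "z \<in> G \<eta>"
  shows "\<exists>\<zeta>\<in>Nvec n. y \<in> G \<zeta> \<and> z \<in> G \<zeta>"
  using Ord.r_total[OF assms(1,2)] G_mono assms by blast

text \<open>The union is a unital subalgebra containing \<open>A\<close> and all letters, hence
  everything by EA2.\<close>

lemma G_exhaustive: "(\<Union>\<theta>\<in>Nvec n. G \<theta>) = carrier B" (is "?U = _")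
proof
  show sub: "?U \<subseteq> carrier B" using span_closed by blast
  note E = submoduleE[OF weighted_span_submodule]
  have neg: "\<ominus>\<^bsub>B\<^esub> a \<in> ?U" if "a \<in> ?U" for a using that E(3) by blast
  have add: "a \<oplus>\<^bsub>B\<^esub> b \<in> ?U" if a: "a \<in> ?U" and b: "b \<in> ?U" for a b
  proof -
    obtain \<theta> \<eta> where "\<theta> \<in> Nvec n" "\<eta> \<in> Nvec n" "a \<in> G \<theta>" "b \<in> G \<eta>"
      using a b by blast
    from G_common[OF this] obtain \<zeta> where "\<zeta> \<in> Nvec n" "a \<in> G \<zeta>" "b \<in> G \<zeta>" by blast
    then show ?thesis using span_add by blast
  qed
  have mult: "a \<otimes>\<^bsub>B\<^esub> b \<in> ?U" if a: "a \<in> ?U" and b: "b \<in> ?U" for a b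
  proof -
    obtain \<theta> \<eta> where "\<theta> \<in> Nvec n" "\<eta> \<in> Nvec n" "a \<in> G \<theta>" "b \<in> G \<eta>"
      using a b by blast
    then show ?thesis using G_mult_G[of \<theta> \<eta> a b] add_in_Nvec[of \<theta> n \<eta>] by blast
  qed
  have smult: "k \<odot>\<^bsub>B\<^esub> a \<in> ?U" if "k \<in> carrier K" "a \<in> ?U" for k a using that E(4) by blast
  have one: "\<one>\<^bsub>B\<^esub> \<in> ?U" using one_in_G zero_in_Nvec by blast
  have zero: "\<zero>\<^bsub>B\<^esub> \<in> ?U" using submodule_zero[OF weighted_span_submodule] zero_in_Nvec by blast
  have "unital_subalgebra ?U K B"
    unfolding unital_subalgebra_def
    by (rule conjI[OF B.subringI[OF sub one neg mult add] submoduleI[OF sub zero neg add smult]])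
  moreover have "A \<subseteq> ?U"
  proof
    fix a assume "a \<in> A"
    then obtain \<alpha> where \<alpha>: "\<alpha> \<in> Nvec m" "a \<in> F \<alpha>" using F_exhaustive by blast
    \<comment> \<open>Elements of \<open>A\<close> and, further down, letters are located by letting
      them act on one, which has degree \<open>0\<close>.\<close>
    have "a \<otimes>\<^bsub>B\<^esub> \<one>\<^bsub>B\<^esub> \<in> G (\<phi> \<alpha> + 0)" by (rule F_mult_G[OF \<alpha> one_in_G])
    then have "a \<in> G (\<phi> \<alpha>)" using F_carrier[OF \<alpha>] by simp
    then show "a \<in> ?U" using \<phi>_Nvec[OF \<alpha>(1)] by blast
  qed
  moreover have "x i \<in> ?U" if i: "i < s" for i
  proof -
    have "x i \<otimes>\<^bsub>B\<^esub> \<one>\<^bsub>B\<^esub> \<in> G (0 + \<psi> (unit_vec i))" by (rule x_mult_G[OF i zero_in_Nvec one_in_G])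
    then have "x i \<in> G (\<psi> (unit_vec i))" using i by simp
    moreover have "\<psi> (unit_vec i) \<in> Nvec n" using i by simp
    ultimately show ?thesis by blast
  qed
  ultimately have "generated_subalgebra K B (A \<union> x ` {..<s}) \<subseteq> ?U"
    unfolding generated_subalgebra_def by (intro Inter_lower) auto
  then show "carrier B \<subseteq> ?U" by (simp only: EA2)
qed

lemma filtered_algebra_G: "filtered_algebra K B n r G"
proof (intro filtered_algebra.intro filtered_algebra_axioms.intro)
  show "assoc_algebra K B" by (fact assoc_algebra_axioms)
  show "admissible_order n r" by (fact Ord.admissible_order_axioms)
  show "submodule (G \<alpha>) K B" for \<alpha> by (rule weighted_span_submodule)
  show "G \<alpha> \<subseteq> G \<beta>" if "(\<alpha>, \<beta>) \<in> r" for \<alpha> \<beta> by (rule G_mono[OF that])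
  show "G \<gamma> <#>\<^bsub>B\<^esub> G \<delta> \<subseteq> G (\<gamma> + \<delta>)" if "\<gamma> \<in> Nvec n" "\<delta> \<in> Nvec n" for \<gamma> \<delta>
    using G_mult_G[OF that] by (auto simp: set_mult_def)
  show "(\<Union>\<theta>\<in>Nvec n. G \<theta>) = carrier B" by (rule G_exhaustive)
  show "\<one>\<^bsub>B\<^esub> \<in> G 0" by (rule one_in_G)
qed

end

theorem mainTheorem5:
  fixes K :: "('k, 'c) ring_scheme" and B :: "('k, 'b, 'd) module_scheme"
    and m s n :: nat and r1 r2 r :: "(nat \<Rightarrow> nat) rel"
    and \<phi> \<psi> :: "(nat \<Rightarrow> nat) \<Rightarrow> (nat \<Rightarrow> nat)"
    and A :: "'b set" and F :: "(nat \<Rightarrow> nat) \<Rightarrow> 'b set" and x :: "nat \<Rightarrow> 'b"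
  assumes "left_bounded_extension K B m r1 s r2 n r \<phi> \<psi> A F x"
  shows "filtered_algebra K B n r
    (\<lambda>\<alpha>. submodule_sum B
      {(\<alpha>1, \<alpha>2) \<in> Nvec m \<times> Nvec s. (\<phi> \<alpha>1 + \<psi> \<alpha>2, \<alpha>) \<in> r}
      (\<lambda>(\<alpha>1, \<alpha>2). F \<alpha>1 #>\<^bsub>B\<^esub> monomial B s x \<alpha>2))"
  using left_bounded_extension.filtered_algebra_G[OF assms]
  by (simp only: left_bounded_extension.weighted_span_def[OF assms] mem_Collect_eq)

end
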